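(* Let $n$ be a composite integer and $k$ a positive integer. Then $\sum_{j=1}^{n-1} j^{k(n-1)} \equiv -1 \pmod n$ if and only if $n$ is a Giuga Number and $\dfrac{\lambda(n)}{\gcd(\lambda(n),n-1)}$ divides $k$.
   Context: A Giuga Number is a composite integer $n$ such that $p$ divides $n/p-1$ for every prime divisor $p$ of $n$. $\lambda$ is Carmichael's function: $\lambda(n)$ is the smallest positive integer $m$ with $a^m\equiv 1\pmod n$ for all integers $a$ coprime to $n$. *)

theory Defs
  imports "HOL-Number_Theory.Number_Theory"
begin

definition composite :: "nat \<Rightarrow> bool" where
  "composite n \<longleftrightarrow> n > 1 \<and> \<not> prime n"

text \<open>
  Both the division and the natural-number subtraction are exact here: if \<open>p\<close> divides
  the positive number \<open>n\<close>, then \<open>n div p \<ge> 1\<close>.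
\<close>
definition Giuga_number :: "nat \<Rightarrow> bool" where
  "Giuga_number n \<longleftrightarrow> composite n \<and> (\<forall>p. prime p \<and> p dvd n \<longrightarrow> p dvd (n div p - 1))"

text \<open>
  The library defines \<^const>\<open>Carmichael\<close> as the least common multiple of the orders of the
  units modulo \<open>n\<close>; this is the smallest universal exponent for the units modulo \<open>n\<close>.
\<close>
lemma Carmichael_eq_Least:
  assumes "n > 0"
  shows "Carmichael n = (LEAST m. m > 0 \<and> (\<forall>a::int. coprime a (int n) \<longrightarrow> [a ^ m = 1] (mod int n)))"
proof (rule Least_equality [symmetric], intro conjI allI impI)
  show "Carmichael n > 0"
    by simp
next
  fix a :: int
  assume a: "coprime a (int n)"
  define b where "b = nat (a mod int n)"
  have b: "int b = a mod int n"
    using assms by (simp add: b_def)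
  have "coprime (int b) (int n)"
    using a assms by (simp add: b)
  then have "coprime n b"
    by (simp add: coprime_commute)
  then have "[b ^ Carmichael n = 1] (mod n)"
    by (intro Carmichael_divides) auto
  then have "[int b ^ Carmichael n = 1] (mod int n)"
    using cong_int_iff [of "b ^ Carmichael n" 1 n] by simp
  moreover have "[int b = a] (mod int n)"
    by (simp add: b cong_def)
  ultimately show "[a ^ Carmichael n = 1] (mod int n)"
    by (meson cong_pow cong_sym cong_trans)
next
  fix m :: nat
  assume m: "m > 0 \<and> (\<forall>a::int. coprime a (int n) \<longrightarrow> [a ^ m = 1] (mod int n))"
  have "ord n a dvd m" if "a \<in> totatives n" for a
  proof -
    have "coprime (int a) (int n)"
      using that by (simp add: totatives_def)
    with m have "[int a ^ m = 1] (mod int n)"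
      by blast
    then have "[a ^ m = 1] (mod n)"
      using cong_int_iff [of "a ^ m" 1 n] by simp
    then show ?thesis
      using ord_divides by blast
  qed
  then have "Carmichael n dvd m"
    unfolding Carmichael_def by (auto intro: Lcm_least)
  with m show "Carmichael n \<le> m"
    by (auto intro: dvd_imp_le)
qed

end

(* For a prime p dividing n, the numbers 0, ..., n - 1 run n/p times through the residues
   modulo p, so with e = k (n - 1) the sum is congruent to -(n/p) modulo p if p - 1 divides e,
   and to 0 otherwise. It is therefore congruent to -1 modulo p exactly if p - 1 divides e and
   p divides n/p - 1. The latter for all p forces n to be squarefree; then the congruences
   modulo the primes p amount to the one modulo n, and p - 1 dividing e for all p means that
   \<lambda>(n) divides e. *)
theory Submission
  imports Defs "HOL-Computational_Algebra.Squarefree"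
begin

text \<open>Every prime has multiplicity at most 1 in \<open>n\<close>, so a single factor
  \<open>p\<close> in \<open>x\<close> is enough. This replaces the Chinese remainder theorem, both
  for the power sum and for \<open>a ^ e - 1\<close>.\<close>

lemma squarefree_dvdI:
  fixes n x :: "'a :: factorial_semiring"
  assumes "squarefree n" and "\<And>p. prime p \<Longrightarrow> p dvd n \<Longrightarrow> p dvd x"
  shows "n dvd x"
proof (cases "x = 0")
  case False
  have "n \<noteq> 0"
    using assms(1) by auto
  have "multiplicity p n \<le> multiplicity p x" if p: "prime p" for p
  proof (cases "p dvd n")
    case True
    then have "multiplicity p x \<ge> 1"
      using assms(2) p False by (intro multiplicity_geI) auto
    moreover have "multiplicity p n \<le> 1"
      using assms(1) p \<open>n \<noteq> 0\<close> by (simp add: squarefree_factorial_semiring'')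
    ultimately show ?thesis
      by simp
  qed (simp add: not_dvd_imp_multiplicity_0)
  then show ?thesis
    using False \<open>n \<noteq> 0\<close> by (simp add: prime_multiplicity_le_imp_dvd)
qed simp

lemma sum_mod_blocks:
  fixes f :: "nat \<Rightarrow> 'a :: comm_semiring_1"
  shows "(\<Sum>j<p * m. f (j mod p)) = of_nat m * (\<Sum>j<p. f j)"
proof -
  have "(\<Sum>j=i * p..<i * p + p. f (j mod p)) = (\<Sum>j<p. f j)" for i
    using sum.shift_bounds_nat_ivl [of "\<lambda>j. f (j mod p)" 0 "i * p" p]
    by (simp add: atLeast0LessThan add.commute)
  then show ?thesis
    using sum.nat_group [of "\<lambda>j. f (j mod p)" p m] by (simp add: mult.commute)
qed

text \<open>With a primitive root \<open>g\<close>, the sum becomes geometric with ratio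
  \<open>x = g ^ e\<close>. If \<open>p - 1\<close> divides \<open>e\<close>, all
  \<open>p - 1\<close> terms are 1 modulo \<open>p\<close>. Otherwise \<open>p\<close> divides
  \<open>x ^ (p - 1) - 1\<close>, which is \<open>x - 1\<close> times the sum, but not
  \<open>x - 1\<close>.\<close>

lemma sum_powers_totatives_prime:
  fixes p e :: nat
  assumes p: "prime p"
  shows "[(\<Sum>j\<in>totatives p. int j ^ e) = (if p - 1 dvd e then - 1 else 0)] (mod int p)"
proof -
  have p1: "p > 1"
    using p by (rule prime_gt_1_nat)
  obtain g where g: "residue_primroot p g"
    using prime_primitive_root_exists [OF p1 p] by blast
  have ord: "ord p g = p - 1" "coprime p g"
    using g p by (simp_all add: residue_primroot_def totient_prime)
  define x where "x = int g ^ e"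
  have x_cong_1: "[x ^ i = 1] (mod int p) \<longleftrightarrow> p - 1 dvd e * i" for i
    using ord_divides [of g "e * i" p] cong_int_iff [of "g ^ (e * i)" 1 p]
    by (simp add: x_def ord power_mult)
  have "(\<Sum>j\<in>totatives p. int j ^ e) = (\<Sum>i<p - 1. int (g ^ i mod p) ^ e)"
    using sum.reindex_bij_betw [OF residue_primroot_is_generator [OF p1 g], of "\<lambda>j. int j ^ e"] p
    by (simp add: totient_prime)
  also have "[\<dots> = (\<Sum>i<p - 1. (int g ^ i) ^ e)] (mod int p)"
    by (intro cong_sum cong_pow) (simp add: cong_def zmod_int)
  also have "(\<Sum>i<p - 1. (int g ^ i) ^ e) = (\<Sum>i<p - 1. x ^ i)"
    by (simp add: x_def mult.commute flip: power_mult)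
  also have "[\<dots> = (if p - 1 dvd e then - 1 else 0)] (mod int p)"
  proof (cases "p - 1 dvd e")
    case True
    then have "[(\<Sum>i<p - 1. x ^ i) = (\<Sum>i<p - 1. 1)] (mod int p)"
      by (intro cong_sum) (simp add: x_cong_1)
    also have "(\<Sum>i<p - 1. 1) = int p - 1"
      using p1 by simp
    also have "[int p - 1 = - 1] (mod int p)"
      by (simp add: cong_iff_dvd_diff)
    finally show ?thesis
      using True by simp
  next
    case False
    then have "\<not> int p dvd x - 1"
      using x_cong_1 [of 1] by (simp add: cong_iff_dvd_diff)
    moreover have "int p dvd (x - 1) * (\<Sum>i<p - 1. x ^ i)"
      using x_cong_1 [of "p - 1"] by (simp add: cong_iff_dvd_diff flip: power_diff_1_eq)
    ultimately show ?thesis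
      using False p by (simp add: cong_0_iff prime_dvd_mult_iff)
  qed
  finally show ?thesis .
qed

lemma sum_powers_cong_mod_prime_divisor:
  fixes n p e :: nat
  assumes "prime p" and "p dvd n" and "n > 0" and "e > 0"
  shows "[(\<Sum>j=1..n-1. int j ^ e) = int (n div p) * (if p - 1 dvd e then - 1 else 0)] (mod int p)"
proof -
  have p1: "p > 1"
    using assms(1) by (rule prime_gt_1_nat)
  \<comment> \<open>Since \<open>e > 0\<close>, the term \<open>0 ^ e\<close> vanishes. Applied to
    \<open>n\<close>, this completes the blocks of residues; applied to \<open>p\<close>, it leaves
    only the units modulo \<open>p\<close>.\<close>
  have drop_0: "(\<Sum>j=1..m-1. int j ^ e) = (\<Sum>j<m. int j ^ e)" if "m > 0" for m
    using that \<open>e > 0\<close> by (intro sum.mono_neutral_left) auto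
  have "[(\<Sum>j<n. int j ^ e) = (\<Sum>j<n. int (j mod p) ^ e)] (mod int p)"
    by (intro cong_sum cong_pow) (simp add: cong_def zmod_int)
  also have "(\<Sum>j<n. int (j mod p) ^ e) = int (n div p) * (\<Sum>j<p. int j ^ e)"
    using sum_mod_blocks [of "\<lambda>j. int j ^ e" p "n div p"] \<open>p dvd n\<close> by simp
  also have "(\<Sum>j<p. int j ^ e) = (\<Sum>j\<in>totatives p. int j ^ e)"
  proof -
    have "totatives p = {1..p-1}"
      using assms(1) by (auto simp: totatives_prime)
    then show ?thesis
      using p1 drop_0 [of p] by simp
  qed
  also have "[int (n div p) * \<dots> = int (n div p) * (if p - 1 dvd e then - 1 else 0)] (mod int p)"
    using assms(1) by (intro cong_mult sum_powers_totatives_prime) simp_all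
  finally show ?thesis
    by (simp only: drop_0 [OF \<open>n > 0\<close>])
qed

text \<open>If \<open>p - 1\<close> does not divide \<open>e\<close>, the sum is 0, which differs
  from -1 modulo a prime. Otherwise -(n/p) has to be -1, and the signs cancel.\<close>

lemma sum_powers_cong_minus_1_iff:
  fixes n p e :: nat
  assumes "prime p" and "p dvd n" and "n > 0" and "e > 0"
  shows "[(\<Sum>j=1..n-1. int j ^ e) = - 1] (mod int p) \<longleftrightarrow> p - 1 dvd e \<and> p dvd n div p - 1"
proof -
  \<comment> \<open>Positivity makes the truncated subtraction in \<open>n div p - 1\<close> exact,
    so that it agrees with the integer difference.\<close>
  have "n div p > 0"
    using assms by auto
  have "[(\<Sum>j=1..n-1. int j ^ e) = - 1] (mod int p) \<longleftrightarrow>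
        [int (n div p) * (if p - 1 dvd e then - 1 else 0) = - 1] (mod int p)"
    using sum_powers_cong_mod_prime_divisor [OF assms] by (meson cong_sym cong_trans)
  also have "\<dots> \<longleftrightarrow> p - 1 dvd e \<and> [int (n div p) = 1] (mod int p)"
    using assms(1) dvd_diff_commute [of "int p" 1 "int (n div p)"]
    by (auto simp: cong_iff_dvd_diff)
  also have "[int (n div p) = 1] (mod int p) \<longleftrightarrow> p dvd n div p - 1"
    using \<open>n div p > 0\<close> int_dvd_int_iff [of p "n div p - 1"]
    by (simp add: cong_iff_dvd_diff of_nat_diff)
  finally show ?thesis .
qed

text \<open>If the square of \<open>p\<close> divided \<open>n\<close>, then \<open>p\<close> would
  divide both n/p and n/p - 1, hence 1.\<close>

lemma squarefree_Giuga_number: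
  assumes "Giuga_number n"
  shows "squarefree n"
proof -
  have "n > 1"
    using assms by (simp add: Giuga_number_def composite_def)
  have "\<not> p ^ 2 dvd n" if p: "prime p" for p
  proof
    assume "p ^ 2 dvd n"
    then obtain m where m: "n = p * (p * m)"
      by (metis dvdE power2_eq_square mult.assoc)
    then have "p dvd p * m - 1"
      using assms p by (auto simp: Giuga_number_def)
    moreover have "p * m > 0"
      using m \<open>n > 1\<close> by (cases "p * m = 0") auto
    ultimately have "p dvd 1"
      using dvd_diffD1 [of p "p * m" 1] by simp
    then show False
      using p by simp
  qed
  then show ?thesis
    using \<open>n > 1\<close> by (simp add: squarefree_factorial_semiring)
qed

text \<open>Forwards, \<open>p\<close> is coprime to n/p, so \<lambda>(p) = p - 1 enters
  \<lambda>(n) through an lcm. Backwards, Fermat gives \<open>a ^ e = 1\<close> modulo each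
  \<open>p\<close>, and squarefreeness lifts this to \<open>n\<close>.\<close>

lemma Carmichael_dvd_iff_squarefree:
  assumes "squarefree n"
  shows "Carmichael n dvd e \<longleftrightarrow> (\<forall>p. prime p \<and> p dvd n \<longrightarrow> p - 1 dvd e)"
proof (intro iffI allI impI; (elim conjE)?)
  fix p
  assume e: "Carmichael n dvd e" and p: "prime p" "p dvd n"
  obtain m where m: "n = p * m"
    using p by (elim dvdE)
  have "\<not> p dvd m"
  proof
    assume "p dvd m"
    then have "p ^ 2 dvd n"
      by (simp add: m power2_eq_square)
    then have "is_unit p"
      by (rule squarefreeD [OF assms])
    then show False
      using p by simp
  qed
  then have "coprime p m"
    using p by (intro prime_imp_coprime)
  then have "Carmichael n = lcm (p - 1) (Carmichael m)"
    using p by (simp add: m Carmichael_mult_coprime Carmichael_prime)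
  then have "p - 1 dvd Carmichael n"
    by simp
  then show "p - 1 dvd e"
    using e by (rule dvd_trans)
next
  assume e: "\<forall>p. prime p \<and> p dvd n \<longrightarrow> p - 1 dvd e"
  have "ord n a dvd e" if a: "a \<in> totatives n" for a
  proof -
    have "a > 0" "coprime a n"
      using a by (auto simp: totatives_def)
    have "p dvd a ^ e - 1" if p: "prime p" "p dvd n" for p
    proof -
      have "\<not> p dvd a"
        using \<open>coprime a n\<close> p coprime_common_divisor [of a n p] by auto
      then have "[a ^ (p - 1) = 1] (mod p)"
        using p by (intro fermat_theorem)
      then have "[a ^ e = 1] (mod p)"
        \<comment> \<open>The order of \<open>a\<close> modulo \<open>p\<close> divides
          \<open>p - 1\<close>, which divides \<open>e\<close>.\<close>
        unfolding ord_divides using e p dvd_trans by blast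
      then show ?thesis
        using \<open>a > 0\<close> by (simp add: cong_altdef_nat)
    qed
    then have "n dvd a ^ e - 1"
      by (rule squarefree_dvdI [OF assms])
    then have "[a ^ e = 1] (mod n)"
      using \<open>a > 0\<close> by (simp add: cong_altdef_nat)
    then show ?thesis
      by (simp add: ord_divides')
  qed
  then show "Carmichael n dvd e"
    unfolding Carmichael_def by (intro Lcm_least) blast
qed

text \<open>After cancelling the gcd, the cofactors of \<open>a\<close> and \<open>b\<close> are
  coprime. This turns the condition on \<open>k\<close> in the theorem into \<lambda>(n) dividing
  the exponent \<open>k * (n - 1)\<close>.\<close>

lemma div_gcd_dvd_iff:
  fixes a b k :: nat
  assumes "a > 0"
  shows "a div gcd a b dvd k \<longleftrightarrow> a dvd k * b"
proof -
  define g where "g = gcd a b"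
  have g: "g > 0" "g * (a div g) = a" "g * (b div g) = b"
    using assms by (simp_all add: g_def)
  have "coprime (a div g) (b div g)"
    unfolding g_def using assms by (intro div_gcd_coprime) simp
  then have "a div g dvd k \<longleftrightarrow> a div g dvd k * (b div g)"
    by (simp add: coprime_dvd_mult_left_iff)
  also have "\<dots> \<longleftrightarrow> g * (a div g) dvd g * (k * (b div g))"
    using g(1) by simp
  also have "\<dots> \<longleftrightarrow> a dvd k * b"
    using g(2,3) by (metis mult.left_commute)
  finally show ?thesis
    by (simp add: g_def)
qed

theorem theorem1:
  fixes n k :: nat
  assumes "composite n" and "k > 0"
  shows "[(\<Sum>j=1..n-1. int j ^ (k * (n - 1))) = -1] (mod int n) \<longleftrightarrow>
         Giuga_number n \<and> (Carmichael n div gcd (Carmichael n) (n - 1)) dvd k"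
proof -
  have n: "n > 1"
    using assms(1) by (simp add: composite_def)
  define e where "e = k * (n - 1)"
  have "e > 0"
    using n assms(2) by (simp add: e_def)
  \<comment> \<open>With the sum taken in the natural numbers, being -1 modulo any \<open>m\<close>
    is the divisibility of \<open>S + 1\<close> by \<open>m\<close>, the form that
    \<open>squarefree_dvdI\<close> handles.\<close>
  define S where "S = (\<Sum>j=1..n-1. j ^ e)"
  have S_cong: "[(\<Sum>j=1..n-1. int j ^ e) = - 1] (mod int m) \<longleftrightarrow> m dvd S + 1" for m
    using int_dvd_int_iff [of m "S + 1"] by (simp add: S_def cong_iff_dvd_diff add.commute)
  have prime_iff: "p dvd S + 1 \<longleftrightarrow> p - 1 dvd e \<and> p dvd n div p - 1" if "prime p" "p dvd n" for p
    using sum_powers_cong_minus_1_iff [OF that, of e] n \<open>e > 0\<close> by (simp only: S_cong)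
  have "n dvd S + 1 \<longleftrightarrow> Giuga_number n \<and> Carmichael n dvd e"
  proof
    assume "n dvd S + 1"
    then have *: "p - 1 dvd e \<and> p dvd n div p - 1" if "prime p" "p dvd n" for p
      using prime_iff [OF that] dvd_trans that by blast
    \<comment> \<open>The Giuga property has to come first: it supplies the squarefreeness on which
      the criterion for \<open>Carmichael n dvd e\<close> rests.\<close>
    then have "Giuga_number n"
      using assms(1) by (simp add: Giuga_number_def)
    with * show "Giuga_number n \<and> Carmichael n dvd e"
      by (simp add: Carmichael_dvd_iff_squarefree squarefree_Giuga_number)
  next
    assume *: "Giuga_number n \<and> Carmichael n dvd e"
    then have sf: "squarefree n"
      by (simp add: squarefree_Giuga_number)
    show "n dvd S + 1"
    proof (rule squarefree_dvdI [OF sf])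
      fix p assume "prime p" "p dvd n"
      then show "p dvd S + 1"
        using * sf prime_iff by (simp add: Giuga_number_def Carmichael_dvd_iff_squarefree)
    qed
  qed
  then show ?thesis
    using S_cong [of n] by (simp add: e_def div_gcd_dvd_iff)
qed

end
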